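(* Let $n\ge2$ and let $Q_{4n}$ be the generalized quaternion group of order $4n$ generated by $a,b$ with relations $a^{2n}=e$, $b^2=a^n$, $bab^{-1}=a^{-1}$. Let $\eta$ be a primitive $2n$-th root of unity in $\mathbb{C}$. For each integer $k$ define $\tau_k'\in\mathrm{Map}(Q_{4n},\mathbb{C})$ by $\tau_k'(a^i)=\eta^{ik}+\eta^{-ik}$ and $\tau_k'(ba^i)=0$ for $i=0,1,\dots,2n-1$. Let $\chi_2$ be the one-dimensional character with $\chi_2(a^i)=1$, $\chi_2(ba^i)=-1$ for all $i$. Then for every integer $k$: (1) $\lambda^2(\tau_k')=\chi_2^{k+1}$. (2) For every integer $m\ge1$, $\displaystyle S^{2m-1}(\tau_k')=\sum_{i=1}^m\tau'_{(2i-1)k}$ and $\displaystyle S^{2m}(\tau_k')=\sum_{i=1}^m\tau'_{2ik}+(\chi_2)^{mk}$.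
   Context: For a finite group $G$, $\mathrm{Map}(G,\mathbb{C})$ is the commutative $\mathbb{C}$-algebra of all functions $G\to\mathbb{C}$ with pointwise operations; powers of $\chi_2$ (with possibly negative exponent) are pointwise. Adams operations: $\psi^n(f)(g)=f(g^n)$ for $n\ge1$. The $\lambda$-operations $\lambda^i$ ($i\ge 0$) on $\mathrm{Map}(G,\mathbb{C})$ are defined by letting $\lambda_t(f)=\sum_{i\ge0}\lambda^i(f)t^i$ be the unique formal power series over $\mathrm{Map}(G,\mathbb{C})$ with constant term $1$ satisfying $\sum_{n\ge1}\psi^n(f)(-t)^n=-t\,\bigl(\tfrac{d}{dt}\lambda_t(f)\bigr)\lambda_t(f)^{-1}$. The symmetric power operations $S^i$ are defined by $S_t(f)=\sum_{i\ge0}S^i(f)t^i=(\lambda_{-t}(f))^{-1}$. (If $\chi$ is the character of a finite-dimensional complex representation $V$, then $\lambda^i(\chi)$ and $S^i(\chi)$ are the characters of $\bigwedge^i V$ and $S^i(V)$.) *)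

theory Defs
  imports
    "HOL-Algebra.Generated_Groups"
    "HOL-Computational_Algebra.Formal_Power_Series"
    "HOL-Library.Function_Algebras"
    Complex_Main
begin

text \<open>
  Elements of \<open>Map(G, \<complex>)\<close> are represented by total functions \<open>'g \<Rightarrow> complex\<close> on the
  type underlying \<open>carrier G\<close>, with the pointwise ring structure of \<open>Function_Algebras\<close>; two
  of them denote the same element iff they agree on \<open>carrier G\<close>. For \<open>x \<in> carrier G\<close>, the
  values at \<open>x\<close> of all operations below depend only on the restriction of \<open>f\<close> to
  \<open>carrier G\<close>.
\<close>

definition adams :: "('g, 'm) monoid_scheme \<Rightarrow> nat \<Rightarrow> ('g \<Rightarrow> complex) \<Rightarrow> ('g \<Rightarrow> complex)"
  where "adams G n f = (\<lambda>x. f (x [^]\<^bsub>G\<^esub> n))"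

text \<open>
  \<open>fps_right_inverse L 1\<close> is the multiplicative inverse of a series \<open>L\<close> with constant term
  \<open>1\<close>, over an arbitrary commutative ring.
\<close>

definition is_lambda_series ::
    "('g, 'm) monoid_scheme \<Rightarrow> ('g \<Rightarrow> complex) \<Rightarrow> ('g \<Rightarrow> complex) fps \<Rightarrow> bool"
  where "is_lambda_series G f L \<longleftrightarrow>
    fps_nth L 0 = 1 \<and>
    Abs_fps (\<lambda>n. if n = 0 then 0 else adams G n f * (- 1) ^ n)
      = - fps_X * fps_deriv L * fps_right_inverse L 1"

definition lambda_series ::
    "('g, 'm) monoid_scheme \<Rightarrow> ('g \<Rightarrow> complex) \<Rightarrow> ('g \<Rightarrow> complex) fps"
  where "lambda_series G f = (THE L. is_lambda_series G f L)"

definition lambda_op ::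
    "('g, 'm) monoid_scheme \<Rightarrow> nat \<Rightarrow> ('g \<Rightarrow> complex) \<Rightarrow> ('g \<Rightarrow> complex)"
  where "lambda_op G i f = fps_nth (lambda_series G f) i"

definition sym_series ::
    "('g, 'm) monoid_scheme \<Rightarrow> ('g \<Rightarrow> complex) \<Rightarrow> ('g \<Rightarrow> complex) fps"
  where "sym_series G f = fps_right_inverse (fps_compose (lambda_series G f) (- fps_X)) 1"

definition sym_op ::
    "('g, 'm) monoid_scheme \<Rightarrow> nat \<Rightarrow> ('g \<Rightarrow> complex) \<Rightarrow> ('g \<Rightarrow> complex)"
  where "sym_op G i f = fps_nth (sym_series G f) i"

lemma is_lambda_series_unique_exists: "\<exists>!L. is_lambda_series G f L"
proof -
  define P :: "('a \<Rightarrow> complex) fps"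
    where "P = Abs_fps (\<lambda>n. if n = 0 then 0 else adams G n f * (- 1) ^ n)"
  have iff: "is_lambda_series G f L \<longleftrightarrow> fps_nth L 0 = 1 \<and> P * L = - fps_X * fps_deriv L" for L
  proof (cases "fps_nth L 0 = 1")
    case True
    define R where "R = fps_right_inverse L 1"
    have LR: "L * R = 1"
      unfolding R_def by (rule fps_right_inverse) (simp add: True)
    have "P = - fps_X * fps_deriv L * R \<longleftrightarrow> P * L = - fps_X * fps_deriv L"
    proof
      assume "P = - fps_X * fps_deriv L * R"
      then have "P * L = - fps_X * fps_deriv L * (L * R)" by (simp only: mult_ac)
      then show "P * L = - fps_X * fps_deriv L" by (simp only: LR mult_1_right)
    next
      assume "P * L = - fps_X * fps_deriv L"
      then have "P * (L * R) = - fps_X * fps_deriv L * R" by (simp only: mult.assoc[symmetric])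
      then show "P = - fps_X * fps_deriv L * R" by (simp only: LR mult_1_right)
    qed
    then show ?thesis
      unfolding is_lambda_series_def P_def[symmetric] R_def[symmetric] by (simp only: True simp_thms)
  qed (simp add: is_lambda_series_def)
  define q where "q x = Abs_fps (\<lambda>n. - fps_nth P (Suc n) x)" for x
  define E where "E x = fps_compose (fps_exp 1) (fps_integral0 (q x))" for x
  define L where "L = Abs_fps (\<lambda>n x. fps_nth (E x) n)"
  have dE: "fps_deriv (E x) = E x * q x" for x
    by (simp add: E_def fps_compose_deriv fps_deriv_fps_integral)
  have sum_apply: "sum h A x = (\<Sum>i\<in>A. h i x)"
    for h :: "nat \<Rightarrow> 'a \<Rightarrow> complex" and A :: "nat set" and x
    by (induction A rule: infinite_finite_induct) auto
  have "fps_nth (P * L) n = fps_nth (- fps_X * fps_deriv L) n" for n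
  proof (cases n)
    case 0
    then show ?thesis by (simp add: P_def)
  next
    case (Suc m)
    have "fps_nth (P * L) n x = fps_nth (- fps_X * fps_deriv L) n x" for x
    proof -
      have "fps_nth (P * L) n x = (\<Sum>i=0..Suc m. fps_nth P i x * fps_nth (E x) (Suc m - i))"
        by (simp add: fps_mult_nth Suc sum_apply L_def)
      also have "\<dots> = (\<Sum>i=0..m. fps_nth P (Suc i) x * fps_nth (E x) (m - i))"
        by (subst sum.atLeast0_atMost_Suc_shift) (simp add: P_def)
      also have "\<dots> = - fps_nth (q x * E x) m"
        by (simp add: fps_mult_nth q_def sum_negf)
      also have "\<dots> = - fps_nth (fps_deriv (E x)) m" by (simp only: dE mult.commute)
      also have "\<dots> = fps_nth (- fps_X * fps_deriv L) n x"
        by (simp add: Suc L_def)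
      finally show ?thesis .
    qed
    then show ?thesis by blast
  qed
  then have L: "P * L = - fps_X * fps_deriv L" by (rule fps_ext)
  have L0: "fps_nth L 0 = 1" by (simp add: L_def E_def fun_eq_iff)
  have uniq: "fps_nth M n = fps_nth N n"
    if M: "fps_nth M 0 = 1" "P * M = - fps_X * fps_deriv M"
      and N: "fps_nth N 0 = 1" "P * N = - fps_X * fps_deriv N" for M N n
  proof (induction n rule: less_induct)
    case (less n)
    show ?case
    proof (cases n)
      case 0
      then show ?thesis using M N by simp
    next
      case (Suc m)
      have "fps_nth (P * M) (Suc m) = fps_nth (P * N) (Suc m)"
        unfolding fps_mult_nth
      proof (rule sum.cong)
        fix i assume "i \<in> {0..Suc m}"
        show "fps_nth P i * fps_nth M (Suc m - i) = fps_nth P i * fps_nth N (Suc m - i)"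
          using less[of "Suc m - i"] by (cases "i = 0") (simp_all add: P_def Suc)
      qed simp
      then have eq: "of_nat (Suc m) * fps_nth M (Suc m) = of_nat (Suc m) * fps_nth N (Suc m)"
        unfolding M N by simp
      have "fps_nth M (Suc m) x = fps_nth N (Suc m) x" for x
        using fun_cong[OF eq, of x]
        by (simp only: times_fun_apply of_nat_fun_apply mult_cancel_left of_nat_eq_0_iff) simp
      then show ?thesis using Suc by blast
    qed
  qed
  show ?thesis
    unfolding iff
  proof (rule ex1I[of _ L])
    show "M = L" if "fps_nth M 0 = 1 \<and> P * M = - fps_X * fps_deriv M" for M
      using that L L0 uniq[of M L] by (intro fps_ext) blast
  qed (use L L0 in blast)
qed

definition generalized_quaternion ::
    "nat \<Rightarrow> ('g, 'm) monoid_scheme \<Rightarrow> 'g \<Rightarrow> 'g \<Rightarrow> bool"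
  where "generalized_quaternion n G a b \<longleftrightarrow>
    group G \<and> order G = 4 * n \<and>
    a \<in> carrier G \<and> b \<in> carrier G \<and> generate G {a, b} = carrier G \<and>
    a [^]\<^bsub>G\<^esub> (2 * n) = \<one>\<^bsub>G\<^esub> \<and>
    b [^]\<^bsub>G\<^esub> (2::nat) = a [^]\<^bsub>G\<^esub> n \<and>
    b \<otimes>\<^bsub>G\<^esub> a \<otimes>\<^bsub>G\<^esub> inv\<^bsub>G\<^esub> b = inv\<^bsub>G\<^esub> a"

definition primitive_root_of_unity :: "nat \<Rightarrow> complex \<Rightarrow> bool"
  where "primitive_root_of_unity N z \<longleftrightarrow> z ^ N = 1 \<and> (\<forall>j. 0 < j \<and> j < N \<longrightarrow> z ^ j \<noteq> 1)"

definition one_dim_character :: "('g, 'm) monoid_scheme \<Rightarrow> ('g \<Rightarrow> complex) \<Rightarrow> bool"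
  where "one_dim_character G \<chi> \<longleftrightarrow>
    \<chi> \<in> hom G \<lparr>carrier = UNIV - {0}, monoid.mult = (*), one = 1\<rparr>"

end

(*
  Everything is checked at one group element x at a time. If the Adams operations take the values
  u^m + v^m at x, the lambda-series at x is (1 + ut)(1 + vt), so that lambda^2 = uv and the values
  of the S^m are the complete homogeneous polynomials h_m(u, v) = (u^m + v^m) + uv h_(m-2)(u, v).
  At x = a^i one takes u = eta^(ik) and v = 1/u. At x = b a^i one has x^2 = a^n and eta^n = -1, so
  that v = -u with u^2 = (-1)^k works.
*)
theory Submission
  imports Defs
begin

section \<open>Lambda-series evaluated at one group element\<close>

definition fps_at :: "'g \<Rightarrow> ('g \<Rightarrow> complex) fps \<Rightarrow> complex fps"
  where "fps_at x F = Abs_fps (\<lambda>n. fps_nth F n x)"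

lemma fps_nth_fps_at [simp]: "fps_nth (fps_at x F) n = fps_nth F n x"
  by (simp add: fps_at_def)

lemma fps_at_1 [simp]: "fps_at x 1 = 1"
  by (rule fps_ext) simp

text \<open>Products of functions are pointwise, so evaluation at \<open>x\<close> is a ring
  homomorphism. It carries equations over Map(G, C), which in general has zero divisors, to complex
  series, where t cancels and series with nonzero constant term have inverses.\<close>

lemma fps_at_mult: "fps_at x (F * H) = fps_at x F * fps_at x H"
proof -
  have "sum h A x = (\<Sum>i\<in>A. h i x)" for h :: "nat \<Rightarrow> 'a \<Rightarrow> complex" and A
    by (induction A rule: infinite_finite_induct) auto
  then show ?thesis
    by (intro fps_ext) (simp add: fps_mult_nth)
qed

text \<open>Clearing denominators, \<open>E = (1 + ut)(1 + vt)\<close> solves the same equation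
  \<open>P F = - t F'\<close> with \<open>P = \<Sum>\<^sub>m (u\<^sup>m + v\<^sup>m) (- t)\<^sup>m\<close> as the \<open>\<lambda>\<close>-series at \<open>x\<close>, whence
  \<open>(F / E)' = 0\<close>.\<close>

lemma fps_at_lambda_series:
  fixes u v :: complex
  assumes ad: "\<forall>m>0. adams G m f x = u ^ m + v ^ m"
  shows "fps_at x (lambda_series G f)
      = 1 + fps_const (u + v) * fps_X + fps_const (u * v) * fps_X ^ 2"
proof -
  define L where "L = lambda_series G f"
  define R where "R = fps_right_inverse L 1"
  define P :: "('a \<Rightarrow> complex) fps"
    where "P = Abs_fps (\<lambda>n. if n = 0 then 0 else adams G n f * (- 1) ^ n)"
  have isL: "is_lambda_series G f L"
    unfolding L_def lambda_series_def by (rule theI'[OF is_lambda_series_unique_exists])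
  then have L0: "fps_nth L 0 = 1" and PL: "P = - fps_X * fps_deriv L * R"
    by (simp_all only: is_lambda_series_def P_def R_def)
  have LR: "L * R = 1"
    unfolding R_def by (rule fps_right_inverse) (simp add: L0)
  have "P * L = - fps_X * fps_deriv L * (L * R)"
    by (simp only: PL mult_ac)
  then have "fps_at x (P * L) = fps_at x (- (fps_X * fps_deriv L))"
    by (simp add: LR)
  also have "\<dots> = - (fps_X * fps_deriv (fps_at x L))"
    by (rule fps_ext) (simp add: of_nat_fun_apply)
  finally have PF: "fps_at x P * fps_at x L = - (fps_X * fps_deriv (fps_at x L))"
    by (simp only: fps_at_mult)
  define F where "F = fps_at x L"
  define A where "A = 1 + fps_const u * fps_X"
  define B where "B = 1 + fps_const v * fps_X"
  \<comment> \<open>The geometric series -wt/(1 + wt); degree 0 is left out because the Adams series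
    starts at n = 1.\<close>
  define p where "p w = Abs_fps (\<lambda>n. if n = 0 then 0 else (- w) ^ n)" for w :: complex
  have p: "p w * (1 + fps_const w * fps_X) = - (fps_const w * fps_X)" for w
  proof -
    have "p w * (1 + fps_const w * fps_X) = p w + fps_const w * (fps_X * p w)"
      by (simp add: algebra_simps)
    also have "\<dots> = - (fps_const w * fps_X)"
    proof (rule fps_ext)
      show "fps_nth (p w + fps_const w * (fps_X * p w)) n = fps_nth (- (fps_const w * fps_X)) n" for n
        by (cases n; cases "n - 1") (auto simp: p_def)
    qed
    finally show ?thesis .
  qed
  have P: "fps_at x P = p u + p v"
    by (rule fps_ext) (auto simp: P_def p_def ad power_minus[of u] power_minus[of v] algebra_simps
        minus_one_power_iff)
  \<comment> \<open>\<open>p u * A\<close> is -ut and \<open>p v * B\<close> is -vt, so only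
    polynomials remain beside \<open>F\<close>. The product rule recognises uB + vA as (AB)', and
    the common factor t cancels.\<close>
  have "fps_X * (fps_deriv F * (A * B)) = - ((p u + p v) * F * (A * B))"
    using PF by (simp add: F_def P mult_ac)
  also have "\<dots> = - (F * ((p u * A) * B + (p v * B) * A))"
    by (simp add: algebra_simps)
  also have "\<dots> = fps_X * (F * (fps_const u * B + fps_const v * A))"
    by (simp add: A_def B_def p) (simp add: algebra_simps)
  also have "fps_const u * B + fps_const v * A = fps_deriv (A * B)"
    by (simp add: A_def B_def algebra_simps)
  finally have ode: "fps_deriv F * (A * B) = F * fps_deriv (A * B)"
    by simp
  have AB0: "fps_nth A 0 = 1" "fps_nth B 0 = 1" by (simp_all add: A_def B_def)
  \<comment> \<open>\<open>F * I\<close> is the quotient F/(AB). Differentiating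
    \<open>I * (A * B) = 1\<close> stands in for the quotient rule.\<close>
  define I where "I = inverse (A * B)"
  have I: "I * (A * B) = 1"
    unfolding I_def by (rule inverse_mult_eq_1) (simp add: AB0)
  have "fps_deriv I * (A * B) + I * fps_deriv (A * B) = 0"
    using arg_cong[OF I, of fps_deriv] by (simp only: fps_deriv_mult fps_deriv_1) (simp add: algebra_simps)
  then have dI: "fps_deriv I * (A * B) = - (I * fps_deriv (A * B))"
    by (simp add: eq_neg_iff_add_eq_0)
  have "fps_deriv (F * I) * (A * B) = I * (fps_deriv F * (A * B)) + F * (fps_deriv I * (A * B))"
    by (simp add: algebra_simps)
  also have "\<dots> = 0"
    by (simp only: ode dI) (simp add: algebra_simps)
  finally have "fps_deriv (F * I) * ((A * B) * I) = 0"
    by (simp only: mult.assoc[symmetric]) simp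
  then have "fps_deriv (F * I) = 0"
    using I by (simp only: mult.commute[of "A * B"] mult_1_right)
  then obtain c where c: "F * I = fps_const c"
    by (metis fps_deriv_eq_0_iff)
  \<comment> \<open>\<open>F\<close>, \<open>A\<close> and \<open>B\<close> all have constant term
    1.\<close>
  have "c = 1"
    using arg_cong[OF c, of "\<lambda>H. fps_nth H 0"] by (simp add: F_def L0 I_def AB0)
  then have "F * (I * (A * B)) = A * B"
    using c by (simp only: mult.assoc[symmetric]) simp
  then have "fps_at x (lambda_series G f) = A * B"
    using I by (simp add: F_def L_def)
  also have "\<dots> = 1 + fps_const (u + v) * fps_X + fps_const (u * v) * fps_X ^ 2"
    by (simp add: A_def B_def algebra_simps power2_eq_square flip: fps_const_add fps_const_mult)
  finally show ?thesis .
qed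

section \<open>Second exterior power and symmetric powers from two eigenvalues\<close>

lemma lambda_op_2_at:
  fixes u v :: complex
  assumes "\<forall>m>0. adams G m f x = u ^ m + v ^ m"
  shows "lambda_op G 2 f x = u * v"
proof -
  have "lambda_op G 2 f x = fps_nth (fps_at x (lambda_series G f)) 2"
    by (simp add: lambda_op_def)
  then show ?thesis
    by (simp add: fps_at_lambda_series[OF assms] fps_X_power_nth)
qed

text \<open>At \<open>x\<close> the symmetric series is 1/((1 - ut)(1 - vt)). The recurrence steps
  by two because the claims on S^(2m-1) and S^(2m) are proved by separate inductions within each
  parity.\<close>

lemma sym_op_at:
  fixes u v :: complex
  assumes "\<forall>m>0. adams G m f x = u ^ m + v ^ m"
  shows "sym_op G 0 f x = 1"
    and "sym_op G (Suc 0) f x = u + v"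
    and "sym_op G (m + 2) f x = u ^ (m + 2) + v ^ (m + 2) + u * v * sym_op G m f x"
proof -
  define L where "L = lambda_series G f"
  define M where "M = fps_compose L (- fps_X)"
  define S where "S = fps_at x (sym_series G f)"
  have L0: "fps_nth L 0 = 1"
    using theI'[OF is_lambda_series_unique_exists, of G f]
    by (simp add: L_def lambda_series_def is_lambda_series_def)
  have "M * fps_right_inverse M 1 = 1"
    by (rule fps_right_inverse) (simp add: M_def L0)
  then have MS: "fps_at x M * S = 1"
    by (simp add: S_def sym_series_def M_def L_def flip: fps_at_mult)
  have "fps_at x M = fps_compose (fps_at x L) (- fps_X)"
    by (rule fps_ext) (simp add: M_def fps_compose_uminus' minus_one_power_iff)
  also have "\<dots> = 1 - fps_const (u + v) * fps_X + fps_const (u * v) * fps_X ^ 2"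
    unfolding L_def fps_at_lambda_series[OF assms]
    by (rule fps_ext) (auto simp: fps_compose_uminus' fps_X_power_nth le_Suc_eq)
  finally have M: "fps_at x M = 1 - fps_const (u + v) * fps_X + fps_const (u * v) * fps_X ^ 2" .
  have "S - fps_const (u + v) * (fps_X * S) + fps_const (u * v) * (fps_X ^ 2 * S) = 1"
    using MS by (simp only: M left_diff_distrib distrib_right mult_1_left mult.assoc)
  then have eq: "fps_nth (S - fps_const (u + v) * (fps_X * S) + fps_const (u * v) * (fps_X ^ 2 * S)) i
      = fps_nth 1 i" for i
    by simp
  have s: "sym_op G i f x = fps_nth S i" for i
    by (simp add: S_def sym_op_def)
  show s0: "sym_op G 0 f x = 1"
    using eq[of 0] by (simp add: s fps_X_power_mult_nth)
  show s1: "sym_op G (Suc 0) f x = u + v"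
    using eq[of 1] s0 by (simp add: s fps_X_power_mult_nth)
  have rec: "sym_op G (m + 2) f x = (u + v) * sym_op G (m + 1) f x - u * v * sym_op G m f x" for m
    using eq[of "m + 2"] by (simp add: s fps_X_power_mult_nth) (simp add: algebra_simps)
  \<comment> \<open>These are the coefficients of (1 - ut) S = 1/(1 - vt) and of its mirror image.
    Unlike (u^(m+1) - v^(m+1))/(u - v), they make sense for u = v, which occurs at the
    identity.\<close>
  have step: "sym_op G (m + 1) f x = u * sym_op G m f x + v ^ (m + 1)
      \<and> sym_op G (m + 1) f x = v * sym_op G m f x + u ^ (m + 1)" for m
  proof (induction m)
    case 0
    show ?case using s0 s1 by simp
  next
    case (Suc m)
    have "sym_op G (m + 2) f x = u * sym_op G (m + 1) f x + v * (sym_op G (m + 1) f x - u * sym_op G m f x)"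
      and "sym_op G (m + 2) f x = v * sym_op G (m + 1) f x + u * (sym_op G (m + 1) f x - v * sym_op G m f x)"
      unfolding rec by (simp_all add: algebra_simps)
    moreover have "sym_op G (m + 1) f x - u * sym_op G m f x = v ^ (m + 1)"
      and "sym_op G (m + 1) f x - v * sym_op G m f x = u ^ (m + 1)"
      using Suc.IH by (metis add_diff_cancel_left')+
    ultimately show ?case by simp
  qed
  \<comment> \<open>Using one half of \<open>step\<close> and then the other yields both pure powers
    and the factor uv.\<close>
  have "sym_op G (m + 2) f x = u * sym_op G (m + 1) f x + v ^ (m + 2)"
    using step[of "m + 1"] by simp
  also have "sym_op G (m + 1) f x = v * sym_op G m f x + u ^ (m + 1)"
    using step by blast
  finally show "sym_op G (m + 2) f x = u ^ (m + 2) + v ^ (m + 2) + u * v * sym_op G m f x"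
    by (simp add: algebra_simps)
qed

text \<open>The case of rotations. With uv = 1 each recurrence step just adds a power sum, starting
  from h_0 = 1 and h_1 = u + v.\<close>

lemma sym_op_at_inverse_pair:
  fixes u v :: complex
  assumes ad: "\<forall>m>0. adams G m f x = u ^ m + v ^ m" and uv: "u * v = 1"
  shows "sym_op G (2 * m + 1) f x = (\<Sum>i=1..m + 1. u ^ (2 * i - 1) + v ^ (2 * i - 1))"
    and "sym_op G (2 * m) f x = (\<Sum>i=1..m. u ^ (2 * i) + v ^ (2 * i)) + 1"
proof -
  note s = sym_op_at[where u = u and v = v, OF ad]
  show "sym_op G (2 * m + 1) f x = (\<Sum>i=1..m + 1. u ^ (2 * i - 1) + v ^ (2 * i - 1))"
  proof (induction m)
    case 0
    show ?case using s(2) by simp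
  next
    case (Suc m)
    show ?case using s(3)[of "2 * m + 1"] Suc uv by simp
  qed
  show "sym_op G (2 * m) f x = (\<Sum>i=1..m. u ^ (2 * i) + v ^ (2 * i)) + 1"
  proof (induction m)
    case 0
    show ?case using s(1) by simp
  next
    case (Suc m)
    show ?case using s(3)[of "2 * m"] Suc uv by simp
  qed
qed

text \<open>The case of the elements b a^i. Here the series is 1/(1 - u^2 t^2); in the recurrence,
  the power sum 2u^(2m+2) loses one copy to -u^2 h_(2m).\<close>

lemma sym_op_at_opposite_pair:
  fixes u :: complex
  assumes ad: "\<forall>m>0. adams G m f x = u ^ m + (- u) ^ m"
  shows "sym_op G (2 * m + 1) f x = 0"
    and "sym_op G (2 * m) f x = (u ^ 2) ^ m"
proof -
  note s = sym_op_at[where u = u and v = "- u", OF ad]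
  show "sym_op G (2 * m + 1) f x = 0"
  proof (induction m)
    case 0
    show ?case using s(2) by simp
  next
    case (Suc m)
    show ?case using s(3)[of "2 * m + 1"] Suc by simp
  qed
  show "sym_op G (2 * m) f x = (u ^ 2) ^ m"
  proof (induction m)
    case 0
    show ?case using s(1) by simp
  next
    case (Suc m)
    show ?case using s(3)[of "2 * m"] Suc
      by (simp add: power_mult power_mult_distrib) (simp add: power2_eq_square algebra_simps)
  qed
qed

section \<open>Multiplication in the generalized quaternion group\<close>

locale quaternion_group = group G
  for G :: "('g, 'm) monoid_scheme" (structure) +
  fixes n :: nat and a b :: 'g
  assumes gq: "generalized_quaternion n G a b" and n_pos: "n > 0"
begin

lemma a_closed [simp]: "a \<in> carrier G" and b_closed [simp]: "b \<in> carrier G"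
  using gq by (auto simp: generalized_quaternion_def)

text \<open>Integer exponents keep the multiplication rules uniform; this reduces them to the range
  0, ..., 2n - 1 in which the characters are specified.\<close>

lemma a_int_pow_mod: "a [^] i = a [^] nat (i mod (2 * int n))"
proof -
  have "a [^] (2 * int n) = \<one>"
    using gq by (simp add: generalized_quaternion_def flip: int_pow_int)
  then have "a [^] (2 * int n * (i div (2 * int n))) = \<one>"
    by (simp flip: int_pow_pow)
  then have "a [^] (2 * int n * (i div (2 * int n)) + i mod (2 * int n)) = a [^] (i mod (2 * int n))"
    by (subst int_pow_mult) simp_all
  also have "\<dots> = a [^] int (nat (i mod (2 * int n)))"
    using n_pos by simp
  finally show ?thesis by (simp only: int_pow_int mult_div_mod_eq)
qed

text \<open>Conjugation by b is an endomorphism sending a to its inverse, hence every power of a to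
  the opposite power.\<close>

lemma a_int_pow_b: "a [^] (i::int) \<otimes> b = b \<otimes> a [^] (- i)"
proof -
  define h where "h x = b \<otimes> x \<otimes> inv b" for x
  have "h \<in> hom G G"
    by (rule homI) (simp_all add: h_def m_assoc inv_solve_left)
  then have "h (a [^] (- i)) = h a [^] (- i)"
    by (intro hom_int_pow is_group) simp_all
  also have "h a = inv a"
    using gq by (simp add: h_def generalized_quaternion_def)
  finally have "b \<otimes> a [^] (- i) \<otimes> inv b = a [^] i"
    by (simp add: h_def int_pow_inv int_pow_neg)
  then show ?thesis
    by (metis a_closed b_closed int_pow_closed inv_closed inv_solve_right m_closed)
qed

lemma b_square: "b \<otimes> b = a [^] int n"
proof -
  have "b [^] (2::nat) = b \<otimes> b"
    by (simp add: numeral_2_eq_2)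
  then show ?thesis
    using gq by (simp add: generalized_quaternion_def int_pow_int)
qed

lemma reflection_mult: "(b \<otimes> a [^] (i::int)) \<otimes> (b \<otimes> a [^] (j::int)) = a [^] (int n + j - i)"
proof -
  have "(b \<otimes> a [^] i) \<otimes> (b \<otimes> a [^] j) = b \<otimes> (a [^] i \<otimes> b) \<otimes> a [^] j"
    by (simp add: m_assoc)
  also have "\<dots> = (b \<otimes> b) \<otimes> (a [^] (- i) \<otimes> a [^] j)"
    unfolding a_int_pow_b by (simp add: m_assoc)
  also have "\<dots> = a [^] (int n + (- i + j))"
    by (simp only: b_square int_pow_mult[OF a_closed])
  finally show ?thesis by (simp add: algebra_simps)
qed

lemma rotation_mult_reflection: "a [^] (i::int) \<otimes> (b \<otimes> a [^] (j::int)) = b \<otimes> a [^] (j - i)"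
proof -
  have "a [^] i \<otimes> (b \<otimes> a [^] j) = (a [^] i \<otimes> b) \<otimes> a [^] j"
    by (simp add: m_assoc)
  also have "\<dots> = b \<otimes> a [^] (- i + j)"
    unfolding a_int_pow_b by (simp add: m_assoc int_pow_mult[OF a_closed, of "- i" j] del: uminus_add_conv_diff)
  finally show ?thesis by simp
qed

lemma inv_b: "inv b = b \<otimes> a [^] (- int n)"
proof -
  have "b \<otimes> (b \<otimes> a [^] (- int n)) = \<one>"
    using reflection_mult[of 0 "- int n"] by simp
  then show ?thesis
    by (intro inv_equality inv_comm[of b]) simp_all
qed

text \<open>The elements a^i and b a^i include the generators and their inverses and are closed
  under products, so they exhaust the generated group.\<close>

lemma carrier_cases:
  assumes "x \<in> carrier G"
  obtains (rotation) i :: int where "x = a [^] i" | (reflection) i :: int where "x = b \<otimes> a [^] i"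
proof -
  have "x \<in> generate G {a, b}"
    using assms gq by (simp add: generalized_quaternion_def)
  then have "(\<exists>i::int. x = a [^] i) \<or> (\<exists>i::int. x = b \<otimes> a [^] i)"
  proof (induction rule: generate.induct)
    case one
    have "\<one> = a [^] (0::int)" by simp
    then show ?case by blast
  next
    case (incl h)
    have "a = a [^] (1::int)" "b = b \<otimes> a [^] (0::int)" by simp_all
    then show ?case using incl by blast
  next
    case (inv h)
    have "inv a = a [^] (- 1::int)" by (simp add: int_pow_neg)
    then show ?case using inv inv_b by blast
  next
    case (eng h1 h2)
    have "(b \<otimes> a [^] i) \<otimes> a [^] j = b \<otimes> a [^] (i + j)" for i j :: int
      by (simp add: m_assoc int_pow_mult)
    then show ?case
      using eng.IH reflection_mult rotation_mult_reflection int_pow_mult[OF a_closed, symmetric]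
      by metis
  qed
  then show ?thesis using that by blast
qed

lemma rotation_pow: "(a [^] (i::int)) [^] (m::nat) = a [^] (i * int m)"
  by (simp add: int_pow_pow flip: int_pow_int)

text \<open>Every b a^i squares to a^n, since the exponents i cancel.\<close>

lemma reflection_pow_even: "(b \<otimes> a [^] (i::int)) [^] (2 * l::nat) = a [^] (int n * int l)"
proof -
  have "(b \<otimes> a [^] i) [^] (2::nat) = a [^] int n"
    using reflection_mult[of i i] by (simp add: numeral_2_eq_2)
  then show ?thesis
    by (simp add: rotation_pow flip: nat_pow_pow)
qed

text \<open>Odd powers stay in the coset of b, where every tau'_j vanishes.\<close>

lemma reflection_pow_odd:
  "(b \<otimes> a [^] (i::int)) [^] (2 * l + 1::nat) = b \<otimes> a [^] (i - int n * int l)"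
proof -
  have "(b \<otimes> a [^] i) [^] (2 * l + 1) = (b \<otimes> a [^] i) [^] (2 * l) \<otimes> (b \<otimes> a [^] i)"
    by simp
  then show ?thesis
    by (simp only: reflection_pow_even rotation_mult_reflection)
qed

end

section \<open>Character values and the final case distinction\<close>

lemma primitive_root_power_half:
  assumes "primitive_root_of_unity (2 * n) \<eta>" and "n > 0"
  shows "\<eta> ^ n = - 1"
proof -
  have "(\<eta> ^ n) ^ 2 = 1"
    using assms by (simp add: primitive_root_of_unity_def mult.commute flip: power_mult)
  moreover have "\<eta> ^ n \<noteq> 1"
    using assms by (simp add: primitive_root_of_unity_def)
  ultimately show ?thesis
    by (simp add: power2_eq_1_iff)
qed

theorem proposition6p7p1:
  fixes n :: nat
    and G :: "('g, 'm) monoid_scheme"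
    and a b :: 'g
    and \<eta> :: complex
    and \<tau>' :: "int \<Rightarrow> 'g \<Rightarrow> complex"
    and \<chi>\<^sub>2 :: "'g \<Rightarrow> complex"
    and k :: int
  assumes "n \<ge> 2"
    and "generalized_quaternion n G a b"
    and "primitive_root_of_unity (2 * n) \<eta>"
    and "\<And>j i. i < 2 * n \<Longrightarrow>
           \<tau>' j (a [^]\<^bsub>G\<^esub> i) = \<eta> powi (int i * j) + \<eta> powi (- (int i * j))"
    and "\<And>j i. i < 2 * n \<Longrightarrow> \<tau>' j (b \<otimes>\<^bsub>G\<^esub> a [^]\<^bsub>G\<^esub> i) = 0"
    and "one_dim_character G \<chi>\<^sub>2"
    and "\<And>i. i < 2 * n \<Longrightarrow> \<chi>\<^sub>2 (a [^]\<^bsub>G\<^esub> i) = 1"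
    and "\<And>i. i < 2 * n \<Longrightarrow> \<chi>\<^sub>2 (b \<otimes>\<^bsub>G\<^esub> a [^]\<^bsub>G\<^esub> i) = - 1"
  shows "(\<forall>x\<in>carrier G. lambda_op G 2 (\<tau>' k) x = \<chi>\<^sub>2 x powi (k + 1)) \<and>
         (\<forall>m\<ge>1.
            (\<forall>x\<in>carrier G. sym_op G (2 * m - 1) (\<tau>' k) x
                = (\<Sum>i=1..m. \<tau>' ((2 * int i - 1) * k) x)) \<and>
            (\<forall>x\<in>carrier G. sym_op G (2 * m) (\<tau>' k) x
                = (\<Sum>i=1..m. \<tau>' (2 * int i * k) x) + \<chi>\<^sub>2 x powi (int m * k)))"
proof -
  interpret group G using assms(2) by (simp add: generalized_quaternion_def)
  interpret quaternion_group G n a b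
    using assms(1,2) by unfold_locales simp_all
  have eta_n: "\<eta> ^ n = - 1"
    using primitive_root_power_half[OF assms(3) n_pos] .
  then have eta0: "\<eta> \<noteq> 0" using n_pos by (auto simp: power_0_left)
  have bound: "nat (i mod (2 * int n)) < 2 * n" for i
    using n_pos by (simp add: nat_less_iff)
  \<comment> \<open>Extends the prescribed values of tau' from 0, ..., 2n - 1 to all integer
    exponents.\<close>
  have eta_mod: "\<eta> powi (int (nat (i mod (2 * int n))) * j) = \<eta> powi (i * j)" for i j
  proof -
    have "\<eta> powi (2 * int n) = 1"
      using assms(3) by (simp add: primitive_root_of_unity_def power_int_def nat_mult_distrib)
    then have "\<eta> powi (2 * int n * (i div (2 * int n) * j)) = 1"
      by (subst power_int_mult) simp
    then have "\<eta> powi (2 * int n * (i div (2 * int n) * j) + i mod (2 * int n) * j)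
        = \<eta> powi (i mod (2 * int n) * j)"
      by (subst power_int_add) (simp_all add: eta0)
    moreover have "2 * int n * (i div (2 * int n) * j) + i mod (2 * int n) * j
        = (2 * int n * (i div (2 * int n)) + i mod (2 * int n)) * j"
      by (simp only: algebra_simps)
    ultimately show ?thesis using n_pos by simp
  qed
  have tau_a: "\<tau>' j (a [^]\<^bsub>G\<^esub> i) = \<eta> powi (i * j) + \<eta> powi (- (i * j))" for i j :: int
    unfolding a_int_pow_mod[of i]
    using eta_mod[of i j] eta_mod[of i "- j"] by (simp add: assms(4)[OF bound])
  have tau_b: "\<tau>' j (b \<otimes>\<^bsub>G\<^esub> a [^]\<^bsub>G\<^esub> i) = 0" for i j :: int
    unfolding a_int_pow_mod[of i] by (rule assms(5)[OF bound])
  have chi_a: "\<chi>\<^sub>2 (a [^]\<^bsub>G\<^esub> i) = 1" for i :: int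
    unfolding a_int_pow_mod[of i] by (rule assms(7)[OF bound])
  have chi_b: "\<chi>\<^sub>2 (b \<otimes>\<^bsub>G\<^esub> a [^]\<^bsub>G\<^esub> i) = - 1" for i :: int
    unfolding a_int_pow_mod[of i] by (rule assms(8)[OF bound])
  \<comment> \<open>The odd case is shifted to 2m + 1 to avoid truncated subtraction; it is used at
    m - 1 in the end.\<close>
  have "lambda_op G 2 (\<tau>' k) x = \<chi>\<^sub>2 x powi (k + 1) \<and>
      sym_op G (2 * m + 1) (\<tau>' k) x = (\<Sum>i=1..m + 1. \<tau>' ((2 * int i - 1) * k) x) \<and>
      sym_op G (2 * m) (\<tau>' k) x = (\<Sum>i=1..m. \<tau>' (2 * int i * k) x) + \<chi>\<^sub>2 x powi (int m * k)"
    if x: "x \<in> carrier G" for x m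
    using x
  proof (cases rule: carrier_cases)
    case (rotation i)
    define u where "u = \<eta> powi (i * k)"
    define v where "v = \<eta> powi (- (i * k))"
    have uv: "u * v = 1"
      by (simp add: u_def v_def eta0 flip: power_int_add)
    \<comment> \<open>On rotations psi^r(tau'_k) = tau'_(rk), so this formula gives both the Adams
      values and the sums in the claim.\<close>
    have tau: "\<tau>' (int r * k) x = u ^ r + v ^ r" for r
    proof -
      have "\<eta> powi (i * k * int r) = u ^ r" "\<eta> powi (- (i * k) * int r) = v ^ r"
        unfolding u_def v_def by (simp_all only: power_int_mult power_int_of_nat)
      then show ?thesis by (simp add: rotation tau_a mult_ac)
    qed
    have adams_x: "adams G r (\<tau>' k) x = u ^ r + v ^ r" for r
    proof -
      have "adams G r (\<tau>' k) x = \<tau>' (int r * k) x"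
        by (simp add: adams_def rotation rotation_pow tau_a mult_ac)
      then show ?thesis by (simp only: tau)
    qed
    then have ad: "\<forall>r>0. adams G r (\<tau>' k) x = u ^ r + v ^ r" by blast
    have "(\<Sum>i=1..m + 1. \<tau>' ((2 * int i - 1) * k) x)
        = (\<Sum>i=1..m + 1. u ^ (2 * i - 1) + v ^ (2 * i - 1))"
    proof (rule sum.cong)
      show "\<tau>' ((2 * int i - 1) * k) x = u ^ (2 * i - 1) + v ^ (2 * i - 1)"
        if "i \<in> {1..m + 1}" for i
        using tau[of "2 * i - 1"] that by (simp add: of_nat_diff)
    qed simp
    moreover have "(\<Sum>i=1..m. \<tau>' (2 * int i * k) x) = (\<Sum>i=1..m. u ^ (2 * i) + v ^ (2 * i))"
      by (rule sum.cong) (use tau[of "2 * _"] in simp_all)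
    moreover have "\<chi>\<^sub>2 x = 1" by (simp add: rotation chi_a)
    ultimately show ?thesis
      using lambda_op_2_at[OF ad] sym_op_at_inverse_pair[OF ad uv] uv by simp
  next
    case (reflection i)
    \<comment> \<open>Either square root serves, as only u^2 enters the results. Then u(-u) =
      (-1)^(k+1), which is chi_2(x)^(k+1).\<close>
    define u where "u = csqrt ((- 1) powi k)"
    have u2: "u ^ 2 = (- 1) powi k" by (simp add: u_def)
    have adams_x: "adams G r (\<tau>' k) x = u ^ r + (- u) ^ r" for r
    proof (cases "even r")
      case True
      then obtain l where r: "r = 2 * l" by blast
      \<comment> \<open>Taken at k and at -k: since (-1)^(-kl) = (-1)^(kl), both summands of tau'_k
        at a^(nl) equal u^r, matching u^r + (-u)^r for even r.\<close>
      have "\<eta> powi (int n * int l * j) = (- 1) powi (int l * j)" for j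
        by (simp add: power_int_mult mult.assoc eta_n)
      from this[of k] this[of "- k"]
      have "\<eta> powi (int n * int l * k) = (- 1) powi (k * int l)"
        and "\<eta> powi (- (int n * int l * k)) = (- 1) powi (k * int l)"
        by (simp_all add: power_int_minus_one_minus mult.commute)
      moreover have "(- 1) powi (k * int l) = u ^ r"
        by (simp add: r power_mult u2 power_int_mult)
      ultimately show ?thesis
        using True by (simp add: adams_def reflection r reflection_pow_even tau_a)
    next
      case False
      then obtain l where r: "r = 2 * l + 1" by (elim oddE)
      have "adams G r (\<tau>' k) x = 0"
        unfolding adams_def reflection r reflection_pow_odd by (rule tau_b)
      then show ?thesis using False by simp
    qed
    then have ad: "\<forall>r>0. adams G r (\<tau>' k) x = u ^ r + (- u) ^ r" by blast
    \<comment> \<open>Both sums of tau' vanish here, so only the power of chi_2 survives in even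
      degree.\<close>
    have "\<chi>\<^sub>2 x = - 1" "\<tau>' j x = 0" for j
      by (simp_all add: reflection chi_b tau_b)
    moreover have "(- 1) powi (int m * k) = ((- 1) powi k :: complex) ^ m"
      by (simp add: power_int_mult mult.commute[of "int m"])
    moreover have "u * - u = (- 1) powi (k + 1)"
      using u2 by (simp add: power_int_add power2_eq_square)
    ultimately show ?thesis
      using lambda_op_2_at[OF ad] sym_op_at_opposite_pair[OF ad] by (simp add: u2)
  qed
  note * = this
  show ?thesis
  proof (intro conjI allI impI ballI)
    fix x assume x: "x \<in> carrier G"
    show "lambda_op G 2 (\<tau>' k) x = \<chi>\<^sub>2 x powi (k + 1)" using *[OF x] by blast
    fix m :: nat assume m: "m \<ge> 1"
    show "sym_op G (2 * m) (\<tau>' k) x = (\<Sum>i=1..m. \<tau>' (2 * int i * k) x) + \<chi>\<^sub>2 x powi (int m * k)"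
      using *[OF x] by blast
    show "sym_op G (2 * m - 1) (\<tau>' k) x = (\<Sum>i=1..m. \<tau>' ((2 * int i - 1) * k) x)"
      using *[OF x, of "m - 1"] m by (cases m) simp_all
  qed
qed

end
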